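(* Let $R$ be a right semihereditary ring that is not a right Baer ring. Then there exists a cyclic torsionless right $R$-module $M$ which cannot be decomposed as $M=P\oplus N$ for submodules $P$ and $N$ of $M$ such that $P$ is projective and $N$ is stable.
   Context: Rings are associative with unity, modules are unital. A ring $R$ is right semihereditary if every finitely generated right ideal of $R$ is projective. A ring $R$ is right Baer if for every subset $X\subseteq R$ the right annihilator $\{r\in R : xr=0 \text{ for all } x\in X\}$ is of the form $eR$ for some idempotent $e\in R$. A right $R$-module is torsionless if it embeds as a submodule in a direct product $\prod_{i\in I}R_R$ of copies of $R$ for some index set $I$. A module is called stable if it has no nonzero projective direct summand. *)

theory Defs
  imports "HOL-Algebra.Module" "HOL-Algebra.AbelCoset" "HOL.Hull"
begin

section \<open>Right modules over a ring that need not be commutative\<close>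

text \<open>The library locale \<^locale>\<open>module\<close> requires a commutative ring. We keep its record type
  and its locale \<^locale>\<open>submodule\<close>, which do not depend on commutativity. Throughout,
  \<open>r \<odot>\<^bsub>M\<^esub> x\<close> is the \<^emph>\<open>right\<close> action, that is the element usually written \<open>x r\<close>; this is why the
  associativity law below reads \<open>x (a b) = (x a) b\<close>. The multiplicative fields of the module record
  are never used.\<close>

locale right_module = R?: ring R + M?: abelian_group M for R (structure) and M (structure) +
  assumes rsmult_closed:
      "\<lbrakk>a \<in> carrier R; x \<in> carrier M\<rbrakk> \<Longrightarrow> a \<odot>\<^bsub>M\<^esub> x \<in> carrier M"
    and rsmult_ring_distr:
      "\<lbrakk>a \<in> carrier R; b \<in> carrier R; x \<in> carrier M\<rbrakk> \<Longrightarrow>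
        (a \<oplus>\<^bsub>R\<^esub> b) \<odot>\<^bsub>M\<^esub> x = a \<odot>\<^bsub>M\<^esub> x \<oplus>\<^bsub>M\<^esub> b \<odot>\<^bsub>M\<^esub> x"
    and rsmult_module_distr:
      "\<lbrakk>a \<in> carrier R; x \<in> carrier M; y \<in> carrier M\<rbrakk> \<Longrightarrow>
        a \<odot>\<^bsub>M\<^esub> (x \<oplus>\<^bsub>M\<^esub> y) = a \<odot>\<^bsub>M\<^esub> x \<oplus>\<^bsub>M\<^esub> a \<odot>\<^bsub>M\<^esub> y"
    and rsmult_assoc:
      "\<lbrakk>a \<in> carrier R; b \<in> carrier R; x \<in> carrier M\<rbrakk> \<Longrightarrow>
        (a \<otimes>\<^bsub>R\<^esub> b) \<odot>\<^bsub>M\<^esub> x = b \<odot>\<^bsub>M\<^esub> (a \<odot>\<^bsub>M\<^esub> x)"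
    and rsmult_one:
      "x \<in> carrier M \<Longrightarrow> \<one>\<^bsub>R\<^esub> \<odot>\<^bsub>M\<^esub> x = x"

definition rmodule_hom ::
    "('a, 'r) ring_scheme \<Rightarrow> ('a, 'm) module \<Rightarrow> ('a, 'n) module \<Rightarrow> ('m \<Rightarrow> 'n) set" where
  "rmodule_hom R M N = {h \<in> carrier M \<rightarrow> carrier N.
     (\<forall>x\<in>carrier M. \<forall>y\<in>carrier M. h (x \<oplus>\<^bsub>M\<^esub> y) = h x \<oplus>\<^bsub>N\<^esub> h y) \<and>
     (\<forall>r\<in>carrier R. \<forall>x\<in>carrier M. h (r \<odot>\<^bsub>M\<^esub> x) = r \<odot>\<^bsub>N\<^esub> h x)}"

definition internal_direct_sum ::
    "('a, 'r) ring_scheme \<Rightarrow> ('a, 'm) module \<Rightarrow> 'm set \<Rightarrow> 'm set \<Rightarrow> bool" where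
  "internal_direct_sum R M P N \<longleftrightarrow>
     submodule P R M \<and> submodule N R M \<and> P <+>\<^bsub>M\<^esub> N = carrier M \<and> P \<inter> N = {\<zero>\<^bsub>M\<^esub>}"

definition finitely_generated_module :: "('a, 'r) ring_scheme \<Rightarrow> ('a, 'm) module \<Rightarrow> bool" where
  "finitely_generated_module R M \<longleftrightarrow>
     (\<exists>S. finite S \<and> S \<subseteq> carrier M \<and> (\<lambda>H. submodule H R M) hull S = carrier M)"

definition cyclic_module :: "('a, 'r) ring_scheme \<Rightarrow> ('a, 'm) module \<Rightarrow> bool" where
  "cyclic_module R M \<longleftrightarrow> (\<exists>x\<in>carrier M. carrier M = {r \<odot>\<^bsub>M\<^esub> x |r. r \<in> carrier R})"


section \<open>Products and direct sums of copies of the regular right module\<close>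

definition regular_module :: "('a, 'r) ring_scheme \<Rightarrow> ('a, 'a) module" where
  "regular_module R = \<lparr>carrier = carrier R, mult = undefined, one = undefined,
     zero = \<zero>\<^bsub>R\<^esub>, add = (\<oplus>\<^bsub>R\<^esub>), smult = (\<lambda>r x. x \<otimes>\<^bsub>R\<^esub> r)\<rparr>"

definition power_module :: "('a, 'r) ring_scheme \<Rightarrow> 'i set \<Rightarrow> ('a, 'i \<Rightarrow> 'a) module" where
  "power_module R I = \<lparr>carrier = I \<rightarrow>\<^sub>E carrier R, mult = undefined, one = undefined,
     zero = (\<lambda>i\<in>I. \<zero>\<^bsub>R\<^esub>), add = (\<lambda>f g. \<lambda>i\<in>I. f i \<oplus>\<^bsub>R\<^esub> g i), smult = (\<lambda>r f. \<lambda>i\<in>I. f i \<otimes>\<^bsub>R\<^esub> r)\<rparr>"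

definition free_module :: "('a, 'r) ring_scheme \<Rightarrow> 'i set \<Rightarrow> ('a, 'i \<Rightarrow> 'a) module" where
  "free_module R I = (power_module R I)
     \<lparr>carrier := {f \<in> I \<rightarrow>\<^sub>E carrier R. finite {i \<in> I. f i \<noteq> \<zero>\<^bsub>R\<^esub>}}\<rparr>"

text \<open>A torsionless module of carrier type \<open>'m\<close> embeds in a product indexed by its dual
  \<open>Hom(M, R)\<close>, so index sets of type \<open>'m \<Rightarrow> 'a\<close> suffice.\<close>

definition torsionless :: "('a, 'r) ring_scheme \<Rightarrow> ('a, 'm) module \<Rightarrow> bool" where
  "torsionless R M \<longleftrightarrow> (\<exists>I :: ('m \<Rightarrow> 'a) set. \<exists>h \<in> rmodule_hom R M (power_module R I).
     inj_on h (carrier M))"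

text \<open>Projective modules are the modules isomorphic to a direct summand of a free module. A
  projective module \<open>P\<close> is a direct summand of the free module on its own carrier, so bases of type
  \<open>'m\<close> suffice. The theorems \<open>projective_lifting\<close> and \<open>lifting_imp_projective\<close> below confirm that
  this agrees with the lifting property, the former with respect to modules of all types.\<close>

definition projective_module :: "('a, 'r) ring_scheme \<Rightarrow> ('a, 'm) module \<Rightarrow> bool" where
  "projective_module R P \<longleftrightarrow> right_module R P \<and>
     (\<exists>X :: 'm set. \<exists>P' Q. internal_direct_sum R (free_module R X) P' Q \<and>
        (\<exists>h \<in> rmodule_hom R P ((free_module R X)\<lparr>carrier := P'\<rparr>). bij_betw h (carrier P) P'))"

definition stable_module :: "('a, 'r) ring_scheme \<Rightarrow> ('a, 'm) module \<Rightarrow> bool" where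
  "stable_module R M \<longleftrightarrow> \<not> (\<exists>P Q. internal_direct_sum R M P Q \<and> P \<noteq> {\<zero>\<^bsub>M\<^esub>} \<and>
     projective_module R (M\<lparr>carrier := P\<rparr>))"


section \<open>Right semihereditary and right Baer rings\<close>

definition right_ideal :: "'a set \<Rightarrow> ('a, 'r) ring_scheme \<Rightarrow> bool" where
  "right_ideal I R \<longleftrightarrow> submodule I R (regular_module R)"

definition right_semihereditary :: "('a, 'r) ring_scheme \<Rightarrow> bool" where
  "right_semihereditary R \<longleftrightarrow> (\<forall>I. right_ideal I R \<and>
     finitely_generated_module R ((regular_module R)\<lparr>carrier := I\<rparr>) \<longrightarrow>
     projective_module R ((regular_module R)\<lparr>carrier := I\<rparr>))"

definition right_annihilator :: "('a, 'r) ring_scheme \<Rightarrow> 'a set \<Rightarrow> 'a set" where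
  "right_annihilator R X = {r \<in> carrier R. \<forall>x\<in>X. x \<otimes>\<^bsub>R\<^esub> r = \<zero>\<^bsub>R\<^esub>}"

definition right_Baer :: "('a, 'r) ring_scheme \<Rightarrow> bool" where
  "right_Baer R \<longleftrightarrow> (\<forall>X \<subseteq> carrier R. \<exists>e\<in>carrier R. e \<otimes>\<^bsub>R\<^esub> e = e \<and>
     right_annihilator R X = {e \<otimes>\<^bsub>R\<^esub> r |r. r \<in> carrier R})"


section \<open>Projectivity and the lifting property\<close>

lemma right_module_ring: "right_module R M \<Longrightarrow> ring R"
  and right_module_abelian_group: "right_module R M \<Longrightarrow> abelian_group M"
  by (auto simp: right_module_def)

lemma rmodule_hom_zero:
  assumes "right_module R M" "right_module R N" "h \<in> rmodule_hom R M N"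
  shows "h \<zero>\<^bsub>M\<^esub> = \<zero>\<^bsub>N\<^esub>"
proof -
  interpret M: right_module R M by fact
  interpret N: right_module R N by fact
  have c: "h \<zero>\<^bsub>M\<^esub> \<in> carrier N"
    using assms(3) by (auto simp: rmodule_hom_def)
  have "h (\<zero>\<^bsub>M\<^esub> \<oplus>\<^bsub>M\<^esub> \<zero>\<^bsub>M\<^esub>) = h \<zero>\<^bsub>M\<^esub> \<oplus>\<^bsub>N\<^esub> h \<zero>\<^bsub>M\<^esub>"
    using assms(3) M.M.zero_closed unfolding rmodule_hom_def by blast
  hence "h \<zero>\<^bsub>M\<^esub> = h \<zero>\<^bsub>M\<^esub> \<oplus>\<^bsub>N\<^esub> h \<zero>\<^bsub>M\<^esub>"
    by simp
  thus ?thesis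
    using c N.M.add.l_cancel_one' by metis
qed

lemma right_module_smult_zero:
  assumes "right_module R M" "r \<in> carrier R"
  shows "r \<odot>\<^bsub>M\<^esub> \<zero>\<^bsub>M\<^esub> = \<zero>\<^bsub>M\<^esub>"
proof -
  interpret M: right_module R M by fact
  have "r \<odot>\<^bsub>M\<^esub> \<zero>\<^bsub>M\<^esub> = r \<odot>\<^bsub>M\<^esub> \<zero>\<^bsub>M\<^esub> \<oplus>\<^bsub>M\<^esub> r \<odot>\<^bsub>M\<^esub> \<zero>\<^bsub>M\<^esub>"
    using M.rsmult_module_distr[OF assms(2) M.M.zero_closed M.M.zero_closed] by simp
  thus ?thesis
    using M.rsmult_closed[OF assms(2) M.M.zero_closed] M.M.add.l_cancel_one' by metis
qed

lemma right_module_zero_smult: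
  assumes "right_module R M" "x \<in> carrier M"
  shows "\<zero>\<^bsub>R\<^esub> \<odot>\<^bsub>M\<^esub> x = \<zero>\<^bsub>M\<^esub>"
proof -
  interpret M: right_module R M by fact
  have "\<zero>\<^bsub>R\<^esub> \<odot>\<^bsub>M\<^esub> x = \<zero>\<^bsub>R\<^esub> \<odot>\<^bsub>M\<^esub> x \<oplus>\<^bsub>M\<^esub> \<zero>\<^bsub>R\<^esub> \<odot>\<^bsub>M\<^esub> x"
    using M.rsmult_ring_distr[OF M.R.zero_closed M.R.zero_closed assms(2)] by simp
  thus ?thesis
    using M.rsmult_closed[OF M.R.zero_closed assms(2)] M.M.add.l_cancel_one' by metis
qed

lemma submoduleI_right:
  assumes "right_module R M" "H \<subseteq> carrier M" "\<zero>\<^bsub>M\<^esub> \<in> H"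
    and add: "\<And>x y. x \<in> H \<Longrightarrow> y \<in> H \<Longrightarrow> x \<oplus>\<^bsub>M\<^esub> y \<in> H"
    and smult: "\<And>r x. r \<in> carrier R \<Longrightarrow> x \<in> H \<Longrightarrow> r \<odot>\<^bsub>M\<^esub> x \<in> H"
  shows "submodule H R M"
proof -
  interpret M: right_module R M by fact
  have inv: "\<ominus>\<^bsub>M\<^esub> x \<in> H" if "x \<in> H" for x
  proof -
    have x: "x \<in> carrier M" using that assms(2) by auto
    have m: "\<ominus>\<^bsub>R\<^esub> \<one>\<^bsub>R\<^esub> \<in> carrier R" by simp
    have "(\<ominus>\<^bsub>R\<^esub> \<one>\<^bsub>R\<^esub> \<oplus>\<^bsub>R\<^esub> \<one>\<^bsub>R\<^esub>) \<odot>\<^bsub>M\<^esub> x = (\<ominus>\<^bsub>R\<^esub> \<one>\<^bsub>R\<^esub>) \<odot>\<^bsub>M\<^esub> x \<oplus>\<^bsub>M\<^esub> x"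
      using M.rsmult_ring_distr[OF m M.R.one_closed x] M.rsmult_one[OF x] by simp
    hence "(\<ominus>\<^bsub>R\<^esub> \<one>\<^bsub>R\<^esub>) \<odot>\<^bsub>M\<^esub> x \<oplus>\<^bsub>M\<^esub> x = \<zero>\<^bsub>M\<^esub>"
      using right_module_zero_smult[OF assms(1) x] by (simp add: M.R.l_neg)
    hence "\<ominus>\<^bsub>M\<^esub> x = (\<ominus>\<^bsub>R\<^esub> \<one>\<^bsub>R\<^esub>) \<odot>\<^bsub>M\<^esub> x"
      using M.rsmult_closed[OF m x] x by (metis M.M.minus_equality)
    thus ?thesis using smult[OF m that] by simp
  qed
  show ?thesis
    by (intro submodule.intro subgroup.intro submodule_axioms.intro)
      (use assms inv in \<open>auto simp: a_inv_def\<close>)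
qed

lemma submodule_right_module:
  assumes "right_module R M" "submodule H R M"
  shows "right_module R (M\<lparr>carrier := H\<rparr>)"
proof -
  interpret M: right_module R M by fact
  interpret H: submodule H R M by fact
  have sub: "x \<in> carrier M" if "x \<in> H" for x using that H.subset by auto
  have zero: "\<zero>\<^bsub>M\<^esub> \<in> H" using H.one_closed by simp
  have add: "x \<oplus>\<^bsub>M\<^esub> y \<in> H" if "x \<in> H" "y \<in> H" for x y
    using H.m_closed[OF that] by simp
  have inv: "\<ominus>\<^bsub>M\<^esub> x \<in> H" if "x \<in> H" for x
    using H.m_inv_closed[OF that] by (simp add: a_inv_def)
  have "abelian_group (M\<lparr>carrier := H\<rparr>)"
  proof (rule abelian_groupI, goal_cases)
    case (6 x)
    thus ?case using inv[of x] sub[of x] by (auto simp: M.M.l_neg intro!: bexI[of _ "\<ominus>\<^bsub>M\<^esub> x"])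
  qed (auto simp: sub zero add M.M.a_ac)
  thus ?thesis
    by (intro right_module.intro right_module_axioms.intro)
      (auto simp: sub M.R.ring_axioms M.rsmult_ring_distr M.rsmult_module_distr
        M.rsmult_assoc M.rsmult_one)
qed

lemma right_module_free_module:
  assumes "ring R"
  shows "right_module R (free_module R X)"
proof -
  interpret ring R by fact
  let ?F = "free_module R X"
  have carrier: "f \<in> carrier ?F \<longleftrightarrow>
      f \<in> extensional X \<and> (\<forall>i\<in>X. f i \<in> carrier R) \<and> finite {i \<in> X. f i \<noteq> \<zero>\<^bsub>R\<^esub>}" for f
    by (auto simp: free_module_def PiE_iff)
  have ops: "\<zero>\<^bsub>?F\<^esub> = (\<lambda>i\<in>X. \<zero>\<^bsub>R\<^esub>)" "\<And>f g. f \<oplus>\<^bsub>?F\<^esub> g = (\<lambda>i\<in>X. f i \<oplus>\<^bsub>R\<^esub> g i)"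
    "\<And>r f. r \<odot>\<^bsub>?F\<^esub> f = (\<lambda>i\<in>X. f i \<otimes>\<^bsub>R\<^esub> r)"
    by (simp_all add: free_module_def power_module_def)
  have fin: "finite {i \<in> X. restrict f X i \<noteq> \<zero>\<^bsub>R\<^esub>}"
    if "finite S" "\<And>i. i \<in> X \<Longrightarrow> i \<notin> S \<Longrightarrow> f i = \<zero>\<^bsub>R\<^esub>" for f S
    by (rule finite_subset[OF _ that(1)]) (use that(2) in auto)
  have closed_add: "f \<oplus>\<^bsub>?F\<^esub> g \<in> carrier ?F" if "f \<in> carrier ?F" "g \<in> carrier ?F" for f g
  proof -
    have "finite ({i \<in> X. f i \<noteq> \<zero>\<^bsub>R\<^esub>} \<union> {i \<in> X. g i \<noteq> \<zero>\<^bsub>R\<^esub>})"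
      using that by (simp add: carrier)
    from fin[OF this, of "\<lambda>i. f i \<oplus>\<^bsub>R\<^esub> g i"] show ?thesis
      using that by (simp add: carrier ops)
  qed
  have closed_smult: "r \<odot>\<^bsub>?F\<^esub> f \<in> carrier ?F" if "r \<in> carrier R" "f \<in> carrier ?F" for r f
  proof -
    have "finite {i \<in> X. f i \<noteq> \<zero>\<^bsub>R\<^esub>}"
      using that by (simp add: carrier)
    from fin[OF this, of "\<lambda>i. f i \<otimes>\<^bsub>R\<^esub> r"] show ?thesis
      using that by (simp add: carrier ops)
  qed
  have closed_zero: "\<zero>\<^bsub>?F\<^esub> \<in> carrier ?F"
    using fin[of "{}" "\<lambda>_. \<zero>\<^bsub>R\<^esub>"] by (simp add: carrier ops)
  have neg: "\<exists>g\<in>carrier ?F. g \<oplus>\<^bsub>?F\<^esub> f = \<zero>\<^bsub>?F\<^esub>" if f: "f \<in> carrier ?F" for f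
  proof (rule bexI)
    show "(\<ominus>\<^bsub>R\<^esub> \<one>\<^bsub>R\<^esub>) \<odot>\<^bsub>?F\<^esub> f \<in> carrier ?F"
      by (rule closed_smult) (use f in auto)
    have "x \<otimes>\<^bsub>R\<^esub> (\<ominus>\<^bsub>R\<^esub> \<one>\<^bsub>R\<^esub>) \<oplus>\<^bsub>R\<^esub> x = \<zero>\<^bsub>R\<^esub>" if "x \<in> carrier R" for x
      using that by (simp add: r_minus l_neg)
    thus "(\<ominus>\<^bsub>R\<^esub> \<one>\<^bsub>R\<^esub>) \<odot>\<^bsub>?F\<^esub> f \<oplus>\<^bsub>?F\<^esub> f = \<zero>\<^bsub>?F\<^esub>"
      using f by (auto simp: carrier ops intro!: extensionalityI[of _ X])
  qed
  have "abelian_group ?F"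
  proof (rule abelian_groupI)
    fix f g h assume "f \<in> carrier ?F" "g \<in> carrier ?F" "h \<in> carrier ?F"
    thus "(f \<oplus>\<^bsub>?F\<^esub> g) \<oplus>\<^bsub>?F\<^esub> h = f \<oplus>\<^bsub>?F\<^esub> (g \<oplus>\<^bsub>?F\<^esub> h)"
      by (intro extensionalityI[of _ X]) (auto simp: carrier ops a_assoc)
  next
    fix f g assume "f \<in> carrier ?F" "g \<in> carrier ?F"
    thus "f \<oplus>\<^bsub>?F\<^esub> g = g \<oplus>\<^bsub>?F\<^esub> f"
      by (intro extensionalityI[of _ X]) (auto simp: carrier ops a_comm)
  next
    fix f assume "f \<in> carrier ?F"
    thus "\<zero>\<^bsub>?F\<^esub> \<oplus>\<^bsub>?F\<^esub> f = f"
      by (intro extensionalityI[of _ X]) (auto simp: carrier ops)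
  qed (use closed_add closed_zero neg in auto)
  moreover have "right_module_axioms R ?F"
  proof
    fix a b f assume "a \<in> carrier R" "b \<in> carrier R" "f \<in> carrier ?F"
    thus "(a \<oplus>\<^bsub>R\<^esub> b) \<odot>\<^bsub>?F\<^esub> f = a \<odot>\<^bsub>?F\<^esub> f \<oplus>\<^bsub>?F\<^esub> b \<odot>\<^bsub>?F\<^esub> f"
      by (intro extensionalityI[of _ X]) (auto simp: carrier ops r_distr)
  next
    fix a f g assume "a \<in> carrier R" "f \<in> carrier ?F" "g \<in> carrier ?F"
    thus "a \<odot>\<^bsub>?F\<^esub> (f \<oplus>\<^bsub>?F\<^esub> g) = a \<odot>\<^bsub>?F\<^esub> f \<oplus>\<^bsub>?F\<^esub> a \<odot>\<^bsub>?F\<^esub> g"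
      by (intro extensionalityI[of _ X]) (auto simp: carrier ops l_distr)
  next
    fix a b f assume "a \<in> carrier R" "b \<in> carrier R" "f \<in> carrier ?F"
    thus "(a \<otimes>\<^bsub>R\<^esub> b) \<odot>\<^bsub>?F\<^esub> f = b \<odot>\<^bsub>?F\<^esub> (a \<odot>\<^bsub>?F\<^esub> f)"
      by (intro extensionalityI[of _ X]) (auto simp: carrier ops m_assoc)
  next
    fix f assume "f \<in> carrier ?F"
    thus "\<one>\<^bsub>R\<^esub> \<odot>\<^bsub>?F\<^esub> f = f"
      by (intro extensionalityI[of _ X]) (auto simp: carrier ops)
  qed (rule closed_smult)
  ultimately show ?thesis
    by (intro right_module.intro assms)
qed

definition unit_vector :: "('a, 'r) ring_scheme \<Rightarrow> 'i set \<Rightarrow> 'i \<Rightarrow> 'i \<Rightarrow> 'a" where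
  "unit_vector R X x = (\<lambda>i\<in>X. if i = x then \<one>\<^bsub>R\<^esub> else \<zero>\<^bsub>R\<^esub>)"

lemma unit_vector_closed:
  assumes "ring R" "x \<in> X"
  shows "unit_vector R X x \<in> carrier (free_module R X)"
proof -
  interpret ring R by fact
  have "finite {i \<in> X. unit_vector R X x i \<noteq> \<zero>\<^bsub>R\<^esub>}"
    by (rule finite_subset[of _ "{x}"]) (auto simp: unit_vector_def)
  thus ?thesis
    by (auto simp: free_module_def unit_vector_def)
qed

lemma free_module_hom_exists:
  assumes "right_module R A" and a: "a \<in> X \<rightarrow> carrier A"
  shows "\<exists>h \<in> rmodule_hom R (free_module R X) A. \<forall>x\<in>X. h (unit_vector R X x) = a x"
proof -
  interpret A: right_module R A by fact
  define h where "h = (\<lambda>v. finsum A (\<lambda>x. v x \<odot>\<^bsub>A\<^esub> a x) {x \<in> X. v x \<noteq> \<zero>\<^bsub>R\<^esub>})"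
  let ?F = "free_module R X"
  have vR: "v x \<in> carrier R" if "v \<in> carrier ?F" "x \<in> X" for v x
    using that by (auto simp: free_module_def)
  have cl: "v x \<odot>\<^bsub>A\<^esub> a x \<in> carrier A" if "v \<in> carrier ?F" "x \<in> X" for v x
    using A.rsmult_closed vR[OF that] a that by auto
  have h_eq: "h v = finsum A (\<lambda>x. v x \<odot>\<^bsub>A\<^esub> a x) S"
    if "v \<in> carrier ?F" "finite S" "S \<subseteq> X" "{x \<in> X. v x \<noteq> \<zero>\<^bsub>R\<^esub>} \<subseteq> S" for v S
    unfolding h_def
  proof (rule A.M.add.finprod_mono_neutral_cong_left)
    fix i assume "i \<in> S - {x \<in> X. v x \<noteq> \<zero>\<^bsub>R\<^esub>}"
    hence "i \<in> X" "v i = \<zero>\<^bsub>R\<^esub>" using that by auto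
    thus "v i \<odot>\<^bsub>A\<^esub> a i = \<zero>\<^bsub>A\<^esub>"
      using right_module_zero_smult[OF assms(1)] a by auto
  qed (use that cl in auto)
  have fin: "finite {x \<in> X. v x \<noteq> \<zero>\<^bsub>R\<^esub>}" if "v \<in> carrier ?F" for v
    using that by (auto simp: free_module_def)
  interpret F: right_module R ?F
    by (rule right_module_free_module[OF A.R.ring_axioms])
  have "h \<in> rmodule_hom R ?F A"
    unfolding rmodule_hom_def
  proof (intro CollectI conjI ballI)
    show "h \<in> carrier ?F \<rightarrow> carrier A"
      using cl by (auto simp: h_def intro!: A.M.finsum_closed)
  next
    fix v w assume v: "v \<in> carrier ?F" and w: "w \<in> carrier ?F"
    let ?S = "{x \<in> X. v x \<noteq> \<zero>\<^bsub>R\<^esub>} \<union> {x \<in> X. w x \<noteq> \<zero>\<^bsub>R\<^esub>}"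
    have vw: "(v \<oplus>\<^bsub>?F\<^esub> w) x = v x \<oplus>\<^bsub>R\<^esub> w x" if "x \<in> X" for x
      using that by (simp add: free_module_def power_module_def)
    have "h (v \<oplus>\<^bsub>?F\<^esub> w) = finsum A (\<lambda>x. (v \<oplus>\<^bsub>?F\<^esub> w) x \<odot>\<^bsub>A\<^esub> a x) ?S"
      by (rule h_eq) (use v w fin vw in auto)
    also have "\<dots> = finsum A (\<lambda>x. v x \<odot>\<^bsub>A\<^esub> a x \<oplus>\<^bsub>A\<^esub> w x \<odot>\<^bsub>A\<^esub> a x) ?S"
      by (rule A.M.finsum_cong')
        (use v w cl vw vR a A.rsmult_ring_distr in \<open>auto simp: Pi_iff\<close>)
    also have "\<dots> = finsum A (\<lambda>x. v x \<odot>\<^bsub>A\<^esub> a x) ?S \<oplus>\<^bsub>A\<^esub> finsum A (\<lambda>x. w x \<odot>\<^bsub>A\<^esub> a x) ?S"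
      by (rule A.M.finsum_addf) (use v w cl in auto)
    also have "\<dots> = h v \<oplus>\<^bsub>A\<^esub> h w"
      using h_eq[of v ?S] h_eq[of w ?S] v w fin by auto
    finally show "h (v \<oplus>\<^bsub>?F\<^esub> w) = h v \<oplus>\<^bsub>A\<^esub> h w" .
  next
    fix r v assume r: "r \<in> carrier R" and v: "v \<in> carrier ?F"
    let ?S = "{x \<in> X. v x \<noteq> \<zero>\<^bsub>R\<^esub>}"
    have rv: "(r \<odot>\<^bsub>?F\<^esub> v) x = v x \<otimes>\<^bsub>R\<^esub> r" if "x \<in> X" for x
      using that by (simp add: free_module_def power_module_def)
    have "h (r \<odot>\<^bsub>?F\<^esub> v) = finsum A (\<lambda>x. (r \<odot>\<^bsub>?F\<^esub> v) x \<odot>\<^bsub>A\<^esub> a x) ?S"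
      by (rule h_eq) (use v r fin rv F.rsmult_closed in auto)
    also have "\<dots> = finsum A (\<lambda>x. r \<odot>\<^bsub>A\<^esub> (v x \<odot>\<^bsub>A\<^esub> a x)) ?S"
      by (rule A.M.finsum_cong')
        (use v r cl rv vR a A.rsmult_assoc A.rsmult_closed in \<open>auto simp: Pi_iff\<close>)
    also have "\<dots> = r \<odot>\<^bsub>A\<^esub> finsum A (\<lambda>x. v x \<odot>\<^bsub>A\<^esub> a x) S"
      if "finite S" "S \<subseteq> X" "S = ?S" for S
      unfolding that(3)[symmetric] using that(1,2)
    proof (induction S rule: finite_induct)
      case empty
      thus ?case using right_module_smult_zero[OF assms(1) r] by simp
    next
      case (insert x T)
      have "v y \<odot>\<^bsub>A\<^esub> a y \<in> carrier A" if "y \<in> insert x T" for y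
        using cl[OF v] that insert.prems by auto
      thus ?case using insert A.rsmult_module_distr A.rsmult_closed r
        by (auto simp: Pi_iff)
    qed
    finally show "h (r \<odot>\<^bsub>?F\<^esub> v) = r \<odot>\<^bsub>A\<^esub> h v"
      using fin[OF v] by (auto simp: h_def)
  qed
  moreover have "h (unit_vector R X x) = a x" if "x \<in> X" for x
  proof -
    have "h (unit_vector R X x) = finsum A (\<lambda>y. unit_vector R X x y \<odot>\<^bsub>A\<^esub> a y) {x}"
      by (rule h_eq) (use that unit_vector_closed[OF A.R.ring_axioms] in
        \<open>auto simp: unit_vector_def\<close>)
    also have "\<dots> = unit_vector R X x x \<odot>\<^bsub>A\<^esub> a x"
      using cl[OF unit_vector_closed[OF A.R.ring_axioms that] that]
      by (subst A.M.finsum_insert) auto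
    also have "\<dots> = a x"
      using that a A.rsmult_one by (auto simp: unit_vector_def)
    finally show ?thesis .
  qed
  ultimately show ?thesis by blast
qed

lemma free_module_hom_unique:
  assumes "right_module R B" "f \<in> rmodule_hom R (free_module R X) B"
    "g \<in> rmodule_hom R (free_module R X) B"
    and eq: "\<And>x. x \<in> X \<Longrightarrow> f (unit_vector R X x) = g (unit_vector R X x)"
    and v: "v \<in> carrier (free_module R X)"
  shows "f v = g v"
proof -
  interpret B: right_module R B by fact
  let ?F = "free_module R X"
  interpret F: right_module R ?F
    by (rule right_module_free_module[OF B.R.ring_axioms])
  have add: "k (x \<oplus>\<^bsub>?F\<^esub> y) = k x \<oplus>\<^bsub>B\<^esub> k y"
    if "k = f \<or> k = g" "x \<in> carrier ?F" "y \<in> carrier ?F" for k x y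
    using that assms(2,3) by (auto simp: rmodule_hom_def)
  have smult: "k (r \<odot>\<^bsub>?F\<^esub> x) = r \<odot>\<^bsub>B\<^esub> k x"
    if "k = f \<or> k = g" "x \<in> carrier ?F" "r \<in> carrier R" for k x r
    using that assms(2,3) by (auto simp: rmodule_hom_def)
  have "finite S \<Longrightarrow> v \<in> carrier ?F \<Longrightarrow> {x \<in> X. v x \<noteq> \<zero>\<^bsub>R\<^esub>} = S \<Longrightarrow> f v = g v" for S v
  proof (induction S arbitrary: v rule: finite_induct)
    case empty
    have "v = \<zero>\<^bsub>?F\<^esub>"
    proof (rule extensionalityI)
      show "v \<in> extensional X" using empty.prems(1) by (simp add: free_module_def PiE_iff)
      show "\<zero>\<^bsub>?F\<^esub> \<in> extensional X" by (simp add: free_module_def power_module_def)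
      show "v i = \<zero>\<^bsub>?F\<^esub> i" if "i \<in> X" for i
        using that empty.prems(2) by (auto simp: free_module_def power_module_def)
    qed
    thus ?case
      by (simp only: rmodule_hom_zero[OF F.right_module_axioms assms(1,2)]
        rmodule_hom_zero[OF F.right_module_axioms assms(1,3)])
  next
    case (insert x S)
    have x: "x \<in> X" and Sx: "S \<subseteq> X" using insert.prems by auto
    define w where "w = v(x := \<zero>\<^bsub>R\<^esub>)"
    have suppw: "{y \<in> X. w y \<noteq> \<zero>\<^bsub>R\<^esub>} = S"
      using insert.prems insert.hyps by (auto simp: w_def)
    have vE: "v \<in> X \<rightarrow>\<^sub>E carrier R" using insert.prems by (auto simp: free_module_def)
    have w: "w \<in> carrier ?F"
    proof -
      have "w \<in> X \<rightarrow>\<^sub>E carrier R"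
        using vE x unfolding w_def by (auto simp: PiE_iff extensional_def)
      thus ?thesis using suppw insert.hyps(1) by (simp add: free_module_def)
    qed
    have u: "unit_vector R X x \<in> carrier ?F"
      by (rule unit_vector_closed[OF B.R.ring_axioms x])
    have vx: "v x \<in> carrier R" using vE x by auto
    have v_eq: "v = w \<oplus>\<^bsub>?F\<^esub> (v x \<odot>\<^bsub>?F\<^esub> unit_vector R X x)"
    proof (rule extensionalityI)
      show "v \<in> extensional X" using vE by (simp add: PiE_iff)
      show "w \<oplus>\<^bsub>?F\<^esub> (v x \<odot>\<^bsub>?F\<^esub> unit_vector R X x) \<in> extensional X"
        by (simp add: free_module_def power_module_def)
      show "v i = (w \<oplus>\<^bsub>?F\<^esub> (v x \<odot>\<^bsub>?F\<^esub> unit_vector R X x)) i" if i: "i \<in> X" for i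
      proof -
        have "v i \<in> carrier R" using vE i by auto
        thus ?thesis
          using i vx by (simp add: free_module_def power_module_def w_def unit_vector_def)
      qed
    qed
    have k: "k v = k w \<oplus>\<^bsub>B\<^esub> v x \<odot>\<^bsub>B\<^esub> k (unit_vector R X x)" if "k = f \<or> k = g" for k
    proof -
      have "k v = k (w \<oplus>\<^bsub>?F\<^esub> (v x \<odot>\<^bsub>?F\<^esub> unit_vector R X x))"
        by (rule arg_cong[OF v_eq])
      also have "\<dots> = k w \<oplus>\<^bsub>B\<^esub> v x \<odot>\<^bsub>B\<^esub> k (unit_vector R X x)"
        by (simp only: add[OF that w F.rsmult_closed[OF vx u]] smult[OF that u vx])
      finally show ?thesis .
    qed
    show ?case
      by (simp only: k[of f] k[of g] insert.IH[OF w suppw] eq[OF x] simp_thms)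
  qed
  from this[OF _ v refl] show ?thesis
    using v by (auto simp: free_module_def)
qed

lemma rmodule_hom_compose:
  assumes "f \<in> rmodule_hom R L M" "g \<in> rmodule_hom R M N"
  shows "(\<lambda>x. g (f x)) \<in> rmodule_hom R L N"
  using assms by (auto simp: rmodule_hom_def Pi_iff)

theorem projective_lifting:
  fixes P :: "('a, 'm) module"
  assumes P: "projective_module R P"
    and A: "right_module R A" and B: "right_module R B"
    and g: "g \<in> rmodule_hom R A B" and surj: "g ` carrier A = carrier B"
    and f: "f \<in> rmodule_hom R P B"
  shows "\<exists>h \<in> rmodule_hom R P A. \<forall>x\<in>carrier P. g (h x) = f x"
proof -
  interpret P: right_module R P using P by (simp add: projective_module_def)
  obtain X :: "'m set" and P' Q i where ds: "internal_direct_sum R (free_module R X) P' Q"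
    and i: "i \<in> rmodule_hom R P ((free_module R X)\<lparr>carrier := P'\<rparr>)"
    and bij: "bij_betw i (carrier P) P'"
    using P unfolding projective_module_def by blast
  let ?F = "free_module R X"
  interpret F: right_module R ?F
    by (rule right_module_free_module[OF P.R.ring_axioms])
  interpret P': submodule P' R ?F using ds by (simp add: internal_direct_sum_def)
  interpret Q: submodule Q R ?F using ds by (simp add: internal_direct_sum_def)
  have P'F: "x \<in> carrier ?F" if "x \<in> P'" for x using that P'.subset by auto
  have QF: "x \<in> carrier ?F" if "x \<in> Q" for x using that Q.subset by auto
  have P'add: "x \<oplus>\<^bsub>?F\<^esub> y \<in> P'" if "x \<in> P'" "y \<in> P'" for x y
    using P'.m_closed[OF that] by simp
  have Qadd: "x \<oplus>\<^bsub>?F\<^esub> y \<in> Q" if "x \<in> Q" "y \<in> Q" for x y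
    using Q.m_closed[OF that] by simp
  have P'neg: "\<ominus>\<^bsub>?F\<^esub> x \<in> P'" if "x \<in> P'" for x
    using P'.m_inv_closed[OF that] by (simp add: a_inv_def)
  have Qneg: "\<ominus>\<^bsub>?F\<^esub> x \<in> Q" if "x \<in> Q" for x
    using Q.m_inv_closed[OF that] by (simp add: a_inv_def)
  have ex: "\<exists>p\<in>P'. \<exists>q\<in>Q. v = p \<oplus>\<^bsub>?F\<^esub> q" if "v \<in> carrier ?F" for v
    using that ds unfolding internal_direct_sum_def set_add_def' by blast
  have uniq: "p = p'" if p: "p \<in> P'" "p' \<in> P'" and q: "q \<in> Q" "q' \<in> Q"
    and e: "p \<oplus>\<^bsub>?F\<^esub> q = p' \<oplus>\<^bsub>?F\<^esub> q'" for p p' q q'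
  proof -
    have c: "p \<in> carrier ?F" "p' \<in> carrier ?F" "q \<in> carrier ?F" "q' \<in> carrier ?F"
      using p q P'F QF by auto
    have "\<ominus>\<^bsub>?F\<^esub> p' \<oplus>\<^bsub>?F\<^esub> p = (\<ominus>\<^bsub>?F\<^esub> p' \<oplus>\<^bsub>?F\<^esub> (p \<oplus>\<^bsub>?F\<^esub> q)) \<oplus>\<^bsub>?F\<^esub> \<ominus>\<^bsub>?F\<^esub> q"
      using c by (simp add: F.M.a_assoc F.M.r_neg)
    also have "\<dots> = (\<ominus>\<^bsub>?F\<^esub> p' \<oplus>\<^bsub>?F\<^esub> (p' \<oplus>\<^bsub>?F\<^esub> q')) \<oplus>\<^bsub>?F\<^esub> \<ominus>\<^bsub>?F\<^esub> q"
      by (simp only: e)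
    also have "\<dots> = q' \<oplus>\<^bsub>?F\<^esub> \<ominus>\<^bsub>?F\<^esub> q"
      using c by (simp add: F.M.a_assoc[symmetric] F.M.l_neg)
    finally have "\<ominus>\<^bsub>?F\<^esub> p' \<oplus>\<^bsub>?F\<^esub> p \<in> P' \<inter> Q"
      using p q P'add P'neg Qadd Qneg by (metis IntI)
    hence "\<ominus>\<^bsub>?F\<^esub> p' \<oplus>\<^bsub>?F\<^esub> p = \<zero>\<^bsub>?F\<^esub>"
      using ds by (auto simp: internal_direct_sum_def)
    hence "\<ominus>\<^bsub>?F\<^esub> p = \<ominus>\<^bsub>?F\<^esub> p'"
      using F.M.minus_equality[OF _ c(1) F.M.a_inv_closed[OF c(2)]] by simp
    thus ?thesis using F.M.minus_minus c by metis
  qed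
  define pr where "pr = (\<lambda>v. SOME p. p \<in> P' \<and> (\<exists>q\<in>Q. v = p \<oplus>\<^bsub>?F\<^esub> q))"
  have pr: "pr v \<in> P' \<and> (\<exists>q\<in>Q. v = pr v \<oplus>\<^bsub>?F\<^esub> q)" if "v \<in> carrier ?F" for v
  proof -
    have "\<exists>p. p \<in> P' \<and> (\<exists>q\<in>Q. v = p \<oplus>\<^bsub>?F\<^esub> q)" using ex[OF that] by blast
    from someI_ex[OF this] show ?thesis by (simp only: pr_def)
  qed
  have pr_eq: "pr v = p" if "p \<in> P'" "q \<in> Q" "v = p \<oplus>\<^bsub>?F\<^esub> q" for v p q
  proof -
    have "v \<in> carrier ?F" using that P'F QF by simp
    then obtain q' where "pr v \<in> P'" "q' \<in> Q" "v = pr v \<oplus>\<^bsub>?F\<^esub> q'" using pr by blast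
    thus ?thesis using uniq[of "pr v" p q' q] that by simp
  qed
  have pr_hom: "pr \<in> rmodule_hom R ?F (?F\<lparr>carrier := P'\<rparr>)"
    unfolding rmodule_hom_def
  proof (intro CollectI conjI ballI)
    fix v w assume vw: "v \<in> carrier ?F" "w \<in> carrier ?F"
    then obtain q q' where q: "q \<in> Q" "q' \<in> Q" "v = pr v \<oplus>\<^bsub>?F\<^esub> q" "w = pr w \<oplus>\<^bsub>?F\<^esub> q'"
      using pr by meson
    have p: "pr v \<in> P'" "pr w \<in> P'" using pr vw by auto
    have c: "pr v \<in> carrier ?F" "pr w \<in> carrier ?F" "q \<in> carrier ?F" "q' \<in> carrier ?F"
      using p q P'F QF by auto
    have "(pr v \<oplus>\<^bsub>?F\<^esub> q) \<oplus>\<^bsub>?F\<^esub> (pr w \<oplus>\<^bsub>?F\<^esub> q') = (pr v \<oplus>\<^bsub>?F\<^esub> pr w) \<oplus>\<^bsub>?F\<^esub> (q \<oplus>\<^bsub>?F\<^esub> q')"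
      using c by (simp add: F.M.a_ac)
    hence "v \<oplus>\<^bsub>?F\<^esub> w = (pr v \<oplus>\<^bsub>?F\<^esub> pr w) \<oplus>\<^bsub>?F\<^esub> (q \<oplus>\<^bsub>?F\<^esub> q')"
      using q by simp
    from pr_eq[OF P'add[OF p] Qadd[OF q(1,2)] this]
    show "pr (v \<oplus>\<^bsub>?F\<^esub> w) = pr v \<oplus>\<^bsub>?F\<lparr>carrier := P'\<rparr>\<^esub> pr w" by simp
  next
    fix r v assume r: "r \<in> carrier R" and v: "v \<in> carrier ?F"
    then obtain q where q: "q \<in> Q" "v = pr v \<oplus>\<^bsub>?F\<^esub> q"
      using pr by meson
    have p: "pr v \<in> P'" using pr v by auto
    have "r \<odot>\<^bsub>?F\<^esub> v = r \<odot>\<^bsub>?F\<^esub> pr v \<oplus>\<^bsub>?F\<^esub> r \<odot>\<^bsub>?F\<^esub> q"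
      using F.rsmult_module_distr[OF r P'F[OF p] QF[OF q(1)]] q(2) by simp
    from pr_eq[OF P'.smult_closed[OF r p] Q.smult_closed[OF r q(1)] this]
    show "pr (r \<odot>\<^bsub>?F\<^esub> v) = r \<odot>\<^bsub>?F\<lparr>carrier := P'\<rparr>\<^esub> pr v" by simp
  qed (use pr in auto)
  define j where "j = inv_into (carrier P) i"
  have ji: "j (i x) = x" if "x \<in> carrier P" for x
    using bij that by (simp add: j_def bij_betw_inv_into_left)
  have ij: "i (j y) = y" "j y \<in> carrier P" if "y \<in> P'" for y
    using bij that by (auto simp: j_def bij_betw_inv_into_right bij_betw_def inv_into_into)
  have i_add: "i (x \<oplus>\<^bsub>P\<^esub> y) = i x \<oplus>\<^bsub>?F\<^esub> i y" if "x \<in> carrier P" "y \<in> carrier P" for x y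
    using i that by (auto simp: rmodule_hom_def)
  have i_smult: "i (r \<odot>\<^bsub>P\<^esub> x) = r \<odot>\<^bsub>?F\<^esub> i x" if "r \<in> carrier R" "x \<in> carrier P" for r x
    using i that by (auto simp: rmodule_hom_def)
  have j_hom: "j \<in> rmodule_hom R (?F\<lparr>carrier := P'\<rparr>) P"
    unfolding rmodule_hom_def
  proof (intro CollectI conjI ballI)
    fix x y assume xy: "x \<in> carrier (?F\<lparr>carrier := P'\<rparr>)" "y \<in> carrier (?F\<lparr>carrier := P'\<rparr>)"
    hence "i (j x \<oplus>\<^bsub>P\<^esub> j y) = x \<oplus>\<^bsub>?F\<^esub> y" by (simp add: i_add ij)
    thus "j (x \<oplus>\<^bsub>?F\<lparr>carrier := P'\<rparr>\<^esub> y) = j x \<oplus>\<^bsub>P\<^esub> j y"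
      using ji[of "j x \<oplus>\<^bsub>P\<^esub> j y"] xy ij by simp
  next
    fix r x assume rx: "r \<in> carrier R" "x \<in> carrier (?F\<lparr>carrier := P'\<rparr>)"
    hence "i (r \<odot>\<^bsub>P\<^esub> j x) = r \<odot>\<^bsub>?F\<^esub> x" by (simp add: i_smult ij)
    thus "j (r \<odot>\<^bsub>?F\<lparr>carrier := P'\<rparr>\<^esub> x) = r \<odot>\<^bsub>P\<^esub> j x"
      using ji[of "r \<odot>\<^bsub>P\<^esub> j x"] rx ij P.rsmult_closed by simp
  qed (use ij in auto)
  define k where "k = (\<lambda>v. f (j (pr v)))"
  have k: "k \<in> rmodule_hom R ?F B"
    unfolding k_def by (rule rmodule_hom_compose[OF rmodule_hom_compose[OF pr_hom j_hom] f])
  have "\<exists>a\<in>carrier A. g a = k (unit_vector R X x)" if "x \<in> X" for x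
  proof -
    have "k (unit_vector R X x) \<in> carrier B"
      using k unit_vector_closed[OF P.R.ring_axioms that] by (auto simp: rmodule_hom_def)
    thus ?thesis using surj by (metis imageE)
  qed
  then obtain a where a: "\<And>x. x \<in> X \<Longrightarrow> a x \<in> carrier A"
    "\<And>x. x \<in> X \<Longrightarrow> g (a x) = k (unit_vector R X x)"
    by metis
  then obtain h where h: "h \<in> rmodule_hom R ?F A" "\<And>x. x \<in> X \<Longrightarrow> h (unit_vector R X x) = a x"
    using free_module_hom_exists[OF A, of a X] by auto
  have gh: "g (h v) = k v" if "v \<in> carrier ?F" for v
    by (rule free_module_hom_unique[OF B rmodule_hom_compose[OF h(1) g] k _ that])
      (use h(2) a(2) in auto)
  have iF: "i \<in> rmodule_hom R P ?F"
    using i P'F unfolding rmodule_hom_def by (simp add: Pi_iff)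
  have ix: "i x \<in> P'" if "x \<in> carrier P" for x using bij that by (auto simp: bij_betw_def)
  have "g (h (i x)) = f x" if "x \<in> carrier P" for x
  proof -
    have zQ: "\<zero>\<^bsub>?F\<^esub> \<in> Q" using Q.one_closed by simp
    have "pr (i x) = i x"
      by (rule pr_eq[OF ix[OF that] zQ]) (use P'F[OF ix[OF that]] in simp)
    with gh[OF P'F[OF ix[OF that]]] show ?thesis
      by (simp only: k_def ji[OF that])
  qed
  thus ?thesis by (intro bexI[OF _ rmodule_hom_compose[OF iF h(1)]] ballI)
qed

theorem lifting_imp_projective:
  fixes P :: "('a, 'm) module"
  assumes P: "right_module R P"
    and lift: "\<And>(A :: ('a, 'm \<Rightarrow> 'a) module) (B :: ('a, 'm) module) g f.
      \<lbrakk>right_module R A; right_module R B; g \<in> rmodule_hom R A B; g ` carrier A = carrier B;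
       f \<in> rmodule_hom R P B\<rbrakk> \<Longrightarrow> \<exists>h \<in> rmodule_hom R P A. \<forall>x\<in>carrier P. g (h x) = f x"
  shows "projective_module R P"
proof -
  interpret P: right_module R P by fact
  let ?F = "free_module R (carrier P)"
  interpret F: right_module R ?F
    by (rule right_module_free_module[OF P.R.ring_axioms])
  obtain g where g: "g \<in> rmodule_hom R ?F P"
    and gu: "\<And>x. x \<in> carrier P \<Longrightarrow> g (unit_vector R (carrier P) x) = x"
    using free_module_hom_exists[OF P, of "\<lambda>x. x" "carrier P"] by auto
  have gcl: "g v \<in> carrier P" if "v \<in> carrier ?F" for v
    using g that by (auto simp: rmodule_hom_def)
  have "g ` carrier ?F = carrier P"
  proof
    show "carrier P \<subseteq> g ` carrier ?F"
    proof
      fix x assume "x \<in> carrier P"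
      thus "x \<in> g ` carrier ?F"
        using imageI[OF unit_vector_closed[OF P.R.ring_axioms], of x "carrier P" g] gu[of x] by simp
    qed
  qed (use gcl in auto)
  moreover have "(\<lambda>x. x) \<in> rmodule_hom R P P" by (simp add: rmodule_hom_def)
  ultimately obtain s where s: "s \<in> rmodule_hom R P ?F" and gs: "\<And>x. x \<in> carrier P \<Longrightarrow> g (s x) = x"
    using lift[OF F.right_module_axioms P g] by blast
  have scl: "s x \<in> carrier ?F" if "x \<in> carrier P" for x
    using s that by (auto simp: rmodule_hom_def)
  have s_add: "s (x \<oplus>\<^bsub>P\<^esub> y) = s x \<oplus>\<^bsub>?F\<^esub> s y" if "x \<in> carrier P" "y \<in> carrier P" for x y
    using s that by (auto simp: rmodule_hom_def)
  have s_smult: "s (r \<odot>\<^bsub>P\<^esub> x) = r \<odot>\<^bsub>?F\<^esub> s x" if "r \<in> carrier R" "x \<in> carrier P" for r x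
    using s that by (auto simp: rmodule_hom_def)
  have g_add: "g (x \<oplus>\<^bsub>?F\<^esub> y) = g x \<oplus>\<^bsub>P\<^esub> g y" if "x \<in> carrier ?F" "y \<in> carrier ?F" for x y
    using g that by (auto simp: rmodule_hom_def)
  have g_smult: "g (r \<odot>\<^bsub>?F\<^esub> x) = r \<odot>\<^bsub>P\<^esub> g x" if "r \<in> carrier R" "x \<in> carrier ?F" for r x
    using g that by (auto simp: rmodule_hom_def)
  have s0: "s \<zero>\<^bsub>P\<^esub> = \<zero>\<^bsub>?F\<^esub>" by (rule rmodule_hom_zero[OF P F.right_module_axioms s])
  have g0: "g \<zero>\<^bsub>?F\<^esub> = \<zero>\<^bsub>P\<^esub>" by (rule rmodule_hom_zero[OF F.right_module_axioms P g])
  define P' where "P' = s ` carrier P"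
  define Q where "Q = {v \<in> carrier ?F. g v = \<zero>\<^bsub>P\<^esub>}"
  have "submodule P' R ?F"
  proof (rule submoduleI_right[OF F.right_module_axioms])
    show "\<zero>\<^bsub>?F\<^esub> \<in> P'" using s0 unfolding P'_def by (metis image_eqI P.M.zero_closed)
  next
    fix x y assume "x \<in> P'" "y \<in> P'"
    thus "x \<oplus>\<^bsub>?F\<^esub> y \<in> P'"
      unfolding P'_def by (auto simp: s_add[symmetric])
  next
    fix r x assume "r \<in> carrier R" "x \<in> P'"
    thus "r \<odot>\<^bsub>?F\<^esub> x \<in> P'"
      unfolding P'_def by (auto simp: s_smult[symmetric] P.rsmult_closed)
  qed (auto simp: P'_def scl)
  moreover have "submodule Q R ?F"
    by (rule submoduleI_right[OF F.right_module_axioms])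
      (auto simp: Q_def g0 g_add g_smult F.rsmult_closed right_module_smult_zero[OF P])
  moreover have "P' <+>\<^bsub>?F\<^esub> Q = carrier ?F"
  proof
    show "P' <+>\<^bsub>?F\<^esub> Q \<subseteq> carrier ?F"
      by (auto simp: set_add_def' P'_def Q_def scl)
    show "carrier ?F \<subseteq> P' <+>\<^bsub>?F\<^esub> Q"
    proof
      fix v assume v: "v \<in> carrier ?F"
      let ?p = "s (g v)" let ?q = "s (\<ominus>\<^bsub>P\<^esub> g v) \<oplus>\<^bsub>?F\<^esub> v"
      have gv: "g v \<in> carrier P" "\<ominus>\<^bsub>P\<^esub> g v \<in> carrier P" using gcl[OF v] by auto
      have "?p \<oplus>\<^bsub>?F\<^esub> ?q = s (g v \<oplus>\<^bsub>P\<^esub> \<ominus>\<^bsub>P\<^esub> g v) \<oplus>\<^bsub>?F\<^esub> v"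
        using scl gv v by (simp add: s_add F.M.a_assoc)
      also have "\<dots> = v" using gv v s0 by (simp add: P.M.r_neg)
      finally have "v = ?p \<oplus>\<^bsub>?F\<^esub> ?q" by simp
      moreover have "?q \<in> Q"
        using scl gv v gs by (simp add: Q_def g_add P.M.l_neg)
      moreover have "?p \<in> P'" using gv by (simp add: P'_def)
      ultimately show "v \<in> P' <+>\<^bsub>?F\<^esub> Q" unfolding set_add_def' by blast
    qed
  qed
  moreover have "P' \<inter> Q = {\<zero>\<^bsub>?F\<^esub>}"
  proof -
    have "\<zero>\<^bsub>?F\<^esub> \<in> P'" using s0 unfolding P'_def by (metis image_eqI P.M.zero_closed)
    moreover have "\<zero>\<^bsub>?F\<^esub> \<in> Q" using g0 by (simp add: Q_def)
    moreover have "v = \<zero>\<^bsub>?F\<^esub>" if "v \<in> P'" "v \<in> Q" for v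
      using that gs s0 by (auto simp: P'_def Q_def)
    ultimately show ?thesis by blast
  qed
  ultimately have "internal_direct_sum R ?F P' Q" by (simp add: internal_direct_sum_def)
  moreover have "s \<in> rmodule_hom R P (?F\<lparr>carrier := P'\<rparr>)"
    using s by (auto simp: rmodule_hom_def P'_def)
  moreover have "bij_betw s (carrier P) P'"
    unfolding P'_def by (rule bij_betw_imageI[OF inj_on_inverseI[of _ g] refl]) (rule gs)
  ultimately show ?thesis using P unfolding projective_module_def by blast
qed

end

theory Submission
  imports Defs
begin

text \<open>
  Choose a set \<open>X\<close> whose right annihilator \<open>I\<close> is not generated by an idempotent, and let
  \<open>M = R/I\<close>. This module is cyclic, and it is torsionless because the left multiplications by the
  elements of \<open>X\<close> induce homomorphisms \<open>R/I \<rightarrow> R\<close> that together separate points.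

  Over a right semihereditary ring no nonzero cyclic torsionless module \<open>N\<close> is stable: such an
  \<open>N\<close> has a nonzero homomorphism to \<open>R\<close>, its image is a principal right ideal and therefore
  projective, so the map onto the image splits and \<open>N\<close> has a nonzero projective direct summand
  (\<open>cyclic_torsionless_stable_imp_zero\<close>). Both properties pass to direct summands. Hence in any
  decomposition \<open>M = P \<oplus> N\<close> with \<open>P\<close> projective and \<open>N\<close> stable one has \<open>N = 0\<close>, and \<open>M = P\<close>
  is itself projective. But then \<open>R \<rightarrow> R/I\<close> splits, which makes \<open>I\<close> a direct summand of
  \<open>R\<close> and so generated by an idempotent (\<open>projective_quotient_imp_idempotent\<close>), contrary to the
  choice of \<open>X\<close>.
\<close>

section \<open>Homomorphisms, kernels and splittings\<close>

lemma rmodule_homI: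
  assumes "\<And>x. x \<in> carrier M \<Longrightarrow> h x \<in> carrier N"
    and "\<And>x y. x \<in> carrier M \<Longrightarrow> y \<in> carrier M \<Longrightarrow> h (x \<oplus>\<^bsub>M\<^esub> y) = h x \<oplus>\<^bsub>N\<^esub> h y"
    and "\<And>r x. r \<in> carrier R \<Longrightarrow> x \<in> carrier M \<Longrightarrow> h (r \<odot>\<^bsub>M\<^esub> x) = r \<odot>\<^bsub>N\<^esub> h x"
  shows "h \<in> rmodule_hom R M N"
  using assms by (auto simp: rmodule_hom_def)

lemma rmodule_homD:
  assumes "h \<in> rmodule_hom R M N"
  shows "x \<in> carrier M \<Longrightarrow> h x \<in> carrier N"
    and "x \<in> carrier M \<Longrightarrow> y \<in> carrier M \<Longrightarrow> h (x \<oplus>\<^bsub>M\<^esub> y) = h x \<oplus>\<^bsub>N\<^esub> h y"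
    and "r \<in> carrier R \<Longrightarrow> x \<in> carrier M \<Longrightarrow> h (r \<odot>\<^bsub>M\<^esub> x) = r \<odot>\<^bsub>N\<^esub> h x"
  using assms by (auto simp: rmodule_hom_def)

lemma rmodule_hom_neg:
  assumes "right_module R M" "right_module R N" "h \<in> rmodule_hom R M N" "x \<in> carrier M"
  shows "h (\<ominus>\<^bsub>M\<^esub> x) = \<ominus>\<^bsub>N\<^esub> h x"
proof -
  interpret M: right_module R M by fact
  interpret N: right_module R N by fact
  note h = rmodule_homD[OF assms(3)]
  have "h (\<ominus>\<^bsub>M\<^esub> x) \<oplus>\<^bsub>N\<^esub> h x = h (\<ominus>\<^bsub>M\<^esub> x \<oplus>\<^bsub>M\<^esub> x)"
    using assms(4) by (simp add: h)
  also have "\<dots> = \<zero>\<^bsub>N\<^esub>"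
    using assms(4) rmodule_hom_zero[OF assms(1-3)] by (simp add: M.M.l_neg)
  finally show ?thesis
    using N.M.minus_equality[of "h (\<ominus>\<^bsub>M\<^esub> x)" "h x"] h(1) assms(4) by simp
qed

lemma rmodule_hom_restrict_submodule:
  assumes "h \<in> rmodule_hom R M N" "submodule H R M"
  shows "h \<in> rmodule_hom R (M\<lparr>carrier := H\<rparr>) N"
proof -
  have "x \<in> carrier M" if "x \<in> H" for x
    using subgroup.subset[OF submodule.axioms(1)[OF assms(2)]] that by auto
  thus ?thesis using rmodule_homD[OF assms(1)] by (intro rmodule_homI) auto
qed

lemma submodule_image:
  assumes M: "right_module R M" and N: "right_module R N" and h: "h \<in> rmodule_hom R M N"
  shows "submodule (h ` carrier M) R N"
proof -
  interpret M: right_module R M by fact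
  note h' = rmodule_homD[OF h]
  show ?thesis
  proof (rule submoduleI_right[OF N])
    show "\<zero>\<^bsub>N\<^esub> \<in> h ` carrier M"
      using rmodule_hom_zero[OF M N h] by (metis image_eqI M.M.zero_closed)
  next
    fix x y assume "x \<in> h ` carrier M" "y \<in> h ` carrier M"
    thus "x \<oplus>\<^bsub>N\<^esub> y \<in> h ` carrier M" by (auto simp: h'(2)[symmetric])
  next
    fix r x assume "r \<in> carrier R" "x \<in> h ` carrier M"
    thus "r \<odot>\<^bsub>N\<^esub> x \<in> h ` carrier M" by (auto simp: h'(3)[symmetric] M.rsmult_closed)
  qed (use h' in auto)
qed

lemma submodule_kernel:
  assumes M: "right_module R M" and N: "right_module R N" and h: "h \<in> rmodule_hom R M N"
  shows "submodule {x \<in> carrier M. h x = \<zero>\<^bsub>N\<^esub>} R M"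
proof -
  interpret M: right_module R M by fact
  interpret N: right_module R N by fact
  show ?thesis
    by (rule submoduleI_right[OF M])
      (auto simp: rmodule_homD[OF h] rmodule_hom_zero[OF M N h] M.rsmult_closed
        right_module_smult_zero[OF N])
qed

text \<open>A section \<open>s\<close> of \<open>g\<close> gives the decomposition \<open>v = s (g v) + (v - s (g v))\<close>.\<close>

lemma internal_direct_sum_section_kernel:
  assumes M: "right_module R M" and B: "right_module R B"
    and g: "g \<in> rmodule_hom R M B" and s: "s \<in> rmodule_hom R B M"
    and gs: "\<And>b. b \<in> carrier B \<Longrightarrow> g (s b) = b"
  shows "internal_direct_sum R M (s ` carrier B) {x \<in> carrier M. g x = \<zero>\<^bsub>B\<^esub>}"
proof -
  interpret M: right_module R M by fact
  interpret B: right_module R B by fact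
  let ?K = "{x \<in> carrier M. g x = \<zero>\<^bsub>B\<^esub>}"
  note g' = rmodule_homD[OF g] and s' = rmodule_homD[OF s]
  have s0: "s \<zero>\<^bsub>B\<^esub> = \<zero>\<^bsub>M\<^esub>" by (rule rmodule_hom_zero[OF B M s])
  have "s ` carrier B <+>\<^bsub>M\<^esub> ?K = carrier M"
  proof
    show "s ` carrier B <+>\<^bsub>M\<^esub> ?K \<subseteq> carrier M"
      by (auto simp: set_add_def' s')
    show "carrier M \<subseteq> s ` carrier B <+>\<^bsub>M\<^esub> ?K"
    proof
      fix v assume v: "v \<in> carrier M"
      let ?p = "s (g v)" and ?q = "\<ominus>\<^bsub>M\<^esub> s (g v) \<oplus>\<^bsub>M\<^esub> v"
      have gv: "g v \<in> carrier B" and p: "?p \<in> carrier M" using v g' s' by auto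
      have "v = ?p \<oplus>\<^bsub>M\<^esub> ?q"
        using p v by (simp add: M.M.a_assoc[symmetric] M.M.r_neg)
      moreover have "?q \<in> ?K"
        using p v gv by (simp add: g'(2) rmodule_hom_neg[OF M B g] gs B.M.l_neg)
      ultimately show "v \<in> s ` carrier B <+>\<^bsub>M\<^esub> ?K"
        using gv unfolding set_add_def' by blast
    qed
  qed
  moreover have "s ` carrier B \<inter> ?K = {\<zero>\<^bsub>M\<^esub>}"
    using gs s0 rmodule_hom_zero[OF M B g] by (force simp: image_iff)
  ultimately show ?thesis
    unfolding internal_direct_sum_def
    using submodule_image[OF B M s] submodule_kernel[OF M B g] by blast
qed

text \<open>The lifting property passes to retracts: a map out of the retract is first composed with
  the retraction \<open>t\<close>, then lifted on \<open>P\<close>, and the lift is pulled back along \<open>s\<close>. Since the two modules may have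
  different types, this also shows that projectivity is invariant under isomorphism.\<close>

lemma projective_retract:
  fixes P :: "('a, 'm) module" and Q :: "('a, 'n) module"
  assumes P: "projective_module R P" and Q: "right_module R Q"
    and s: "s \<in> rmodule_hom R Q P" and t: "t \<in> rmodule_hom R P Q"
    and ts: "\<And>x. x \<in> carrier Q \<Longrightarrow> t (s x) = x"
  shows "projective_module R Q"
proof (rule lifting_imp_projective[OF Q])
  fix A :: "('a, 'n \<Rightarrow> 'a) module" and B :: "('a, 'n) module" and g f
  assume A: "right_module R A" and B: "right_module R B" and g: "g \<in> rmodule_hom R A B"
    and surj: "g ` carrier A = carrier B" and f: "f \<in> rmodule_hom R Q B"
  obtain k where k: "k \<in> rmodule_hom R P A" "\<forall>x\<in>carrier P. g (k x) = f (t x)"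
    using projective_lifting[OF P A B g surj rmodule_hom_compose[OF t f]] by blast
  show "\<exists>h\<in>rmodule_hom R Q A. \<forall>x\<in>carrier Q. g (h x) = f x"
    using k rmodule_homD(1)[OF s] ts
    by (intro bexI[OF _ rmodule_hom_compose[OF s k(1)]]) simp
qed

lemma epi_onto_projective_splits:
  assumes M: "right_module R M" and B: "projective_module R B"
    and g: "g \<in> rmodule_hom R M B" and surj: "g ` carrier M = carrier B"
  obtains s where "s \<in> rmodule_hom R B M" "\<And>b. b \<in> carrier B \<Longrightarrow> g (s b) = b"
proof -
  have "right_module R B" using B by (simp add: projective_module_def)
  moreover have "(\<lambda>x. x) \<in> rmodule_hom R B B" by (simp add: rmodule_hom_def)
  ultimately show ?thesis using projective_lifting[OF B M _ g surj] that by blast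
qed

lemma stable_epi_onto_projective_imp_zero:
  assumes M: "right_module R M" and "stable_module R M" and B: "projective_module R B"
    and g: "g \<in> rmodule_hom R M B" and surj: "g ` carrier M = carrier B"
  shows "carrier B = {\<zero>\<^bsub>B\<^esub>}"
proof -
  have Bm: "right_module R B" using B by (simp add: projective_module_def)
  then interpret B: right_module R B .
  obtain s where s: "s \<in> rmodule_hom R B M" and gs: "\<And>b. b \<in> carrier B \<Longrightarrow> g (s b) = b"
    using epi_onto_projective_splits[OF M B g surj] by blast
  let ?S = "s ` carrier B"
  have sub: "submodule ?S R M" by (rule submodule_image[OF Bm M s])
  have s': "s \<in> rmodule_hom R B (M\<lparr>carrier := ?S\<rparr>)"
    using s by (auto simp: rmodule_hom_def)
  have "projective_module R (M\<lparr>carrier := ?S\<rparr>)"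
    by (rule projective_retract[OF B submodule_right_module[OF M sub]
          rmodule_hom_restrict_submodule[OF g sub] s']) (auto simp: gs)
  hence "?S = {\<zero>\<^bsub>M\<^esub>}"
    using assms(2) internal_direct_sum_section_kernel[OF M Bm g s gs]
    unfolding stable_module_def by blast
  hence "b = \<zero>\<^bsub>B\<^esub>" if "b \<in> carrier B" for b
    using gs[OF that] rmodule_hom_zero[OF M Bm g] that by (metis image_eqI singletonD)
  thus ?thesis by auto
qed


section \<open>Torsionless modules\<close>

lemma regular_module_simps [simp]:
  "carrier (regular_module R) = carrier R" "\<zero>\<^bsub>regular_module R\<^esub> = \<zero>\<^bsub>R\<^esub>"
  "x \<oplus>\<^bsub>regular_module R\<^esub> y = x \<oplus>\<^bsub>R\<^esub> y" "r \<odot>\<^bsub>regular_module R\<^esub> x = x \<otimes>\<^bsub>R\<^esub> r"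
  by (simp_all add: regular_module_def)

lemma right_module_regular_module:
  assumes "ring R"
  shows "right_module R (regular_module R)"
proof -
  interpret ring R by fact
  have "abelian_group (regular_module R)"
    by (rule abelian_groupI) (auto simp: a_ac intro: l_neg)
  thus ?thesis
    by (intro right_module.intro right_module_axioms.intro assms)
      (auto simp: m_assoc l_distr r_distr)
qed

lemma regular_module_neg:
  assumes "ring R" "a \<in> carrier R"
  shows "\<ominus>\<^bsub>regular_module R\<^esub> a = \<ominus>\<^bsub>R\<^esub> a"
proof -
  interpret ring R by fact
  show ?thesis
    using abelian_group.minus_equality[OF right_module_abelian_group,
        OF right_module_regular_module[OF assms(1)], of "\<ominus>\<^bsub>R\<^esub> a" a] assms(2)
    by (simp add: l_neg)
qed

text \<open>The coordinates of an embedding into a power of \<open>R\<close> are homomorphisms to \<open>R\<close>. Conversely,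
  if these separate points, evaluation embeds \<open>M\<close> into the power indexed by all of
  \<open>Hom(M, R)\<close>.\<close>

lemma torsionless_iff_homs_separate:
  fixes M :: "('a, 'm) module"
  shows "torsionless R M \<longleftrightarrow> (\<forall>x\<in>carrier M. \<forall>y\<in>carrier M. x \<noteq> y \<longrightarrow>
    (\<exists>f \<in> rmodule_hom R M (regular_module R). f x \<noteq> f y))" (is "_ \<longleftrightarrow> ?sep")
proof
  assume "torsionless R M"
  then obtain I :: "('m \<Rightarrow> 'a) set" and h where h: "h \<in> rmodule_hom R M (power_module R I)"
    and inj: "inj_on h (carrier M)"
    unfolding torsionless_def by blast
  note h' = rmodule_homD[OF h]
  have hE: "h x \<in> I \<rightarrow>\<^sub>E carrier R" if "x \<in> carrier M" for x
    using h'(1)[OF that] by (simp add: power_module_def)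
  have proj: "(\<lambda>x. h x i) \<in> rmodule_hom R M (regular_module R)" if "i \<in> I" for i
    using that hE h'(2,3) by (intro rmodule_homI) (auto simp: power_module_def)
  show ?sep
  proof (intro ballI impI)
    fix x y assume xy: "x \<in> carrier M" "y \<in> carrier M" "x \<noteq> y"
    hence "h x \<noteq> h y" using inj by (auto dest: inj_onD)
    then obtain i where "i \<in> I" "h x i \<noteq> h y i"
      using PiE_ext[OF hE[OF xy(1)] hE[OF xy(2)]] by blast
    thus "\<exists>f \<in> rmodule_hom R M (regular_module R). f x \<noteq> f y"
      by (intro bexI[OF _ proj])
  qed
next
  assume sep: ?sep
  let ?I = "rmodule_hom R M (regular_module R)"
  let ?h = "\<lambda>x. \<lambda>f\<in>?I. f x"
  have "?h \<in> rmodule_hom R M (power_module R ?I)"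
    by (rule rmodule_homI) (auto simp: power_module_def rmodule_hom_def Pi_iff intro!: restrict_ext)
  moreover have "inj_on ?h (carrier M)"
  proof (rule inj_onI, rule ccontr)
    fix x y assume xy: "x \<in> carrier M" "y \<in> carrier M" "?h x = ?h y" "x \<noteq> y"
    then obtain f where "f \<in> ?I" "f x \<noteq> f y" using sep by blast
    thus False using fun_cong[OF xy(3), of f] by simp
  qed
  ultimately show "torsionless R M" unfolding torsionless_def by blast
qed

lemma torsionless_submodule:
  assumes "torsionless R M" "submodule H R M"
  shows "torsionless R (M\<lparr>carrier := H\<rparr>)"
  unfolding torsionless_iff_homs_separate
proof (intro ballI impI)
  fix x y assume "x \<in> carrier (M\<lparr>carrier := H\<rparr>)" "y \<in> carrier (M\<lparr>carrier := H\<rparr>)" "x \<noteq> y"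
  hence "x \<in> carrier M" "y \<in> carrier M" "x \<noteq> y"
    using subgroup.subset[OF submodule.axioms(1)[OF assms(2)]] by auto
  then obtain f where "f \<in> rmodule_hom R M (regular_module R)" "f x \<noteq> f y"
    using assms(1) unfolding torsionless_iff_homs_separate by blast
  thus "\<exists>f \<in> rmodule_hom R (M\<lparr>carrier := H\<rparr>) (regular_module R). f x \<noteq> f y"
    using rmodule_hom_restrict_submodule[OF _ assms(2)] by blast
qed


section \<open>Cyclic modules\<close>

lemma cyclic_module_image:
  assumes h: "h \<in> rmodule_hom R M N" and "cyclic_module R M"
  shows "cyclic_module R (N\<lparr>carrier := h ` carrier M\<rparr>)"
proof -
  obtain x where x: "x \<in> carrier M" "carrier M = {r \<odot>\<^bsub>M\<^esub> x |r. r \<in> carrier R}"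
    using assms(2) unfolding cyclic_module_def by blast
  have "h ` carrier M = (\<lambda>r. h (r \<odot>\<^bsub>M\<^esub> x)) ` carrier R"
    by (subst x(2)) blast
  also have "\<dots> = (\<lambda>r. r \<odot>\<^bsub>N\<^esub> h x) ` carrier R"
    using rmodule_homD(3)[OF h _ x(1)] by (intro image_cong) auto
  finally have "h ` carrier M = {r \<odot>\<^bsub>N\<^esub> h x |r. r \<in> carrier R}" by blast
  thus ?thesis
    using imageI[OF x(1), of h] unfolding cyclic_module_def by (intro bexI[of _ "h x"]) simp_all
qed

text \<open>The component in \<open>N\<close> of a generator of \<open>M\<close> generates \<open>N\<close>.\<close>

lemma cyclic_module_direct_summand:
  assumes M: "right_module R M" and cyc: "cyclic_module R M"
    and ds: "internal_direct_sum R M P N"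
  shows "cyclic_module R (M\<lparr>carrier := N\<rparr>)"
proof -
  interpret M: right_module R M by fact
  interpret P: submodule P R M using ds by (simp add: internal_direct_sum_def)
  interpret N: submodule N R M using ds by (simp add: internal_direct_sum_def)
  obtain x where x: "x \<in> carrier M" "carrier M = {r \<odot>\<^bsub>M\<^esub> x |r. r \<in> carrier R}"
    using cyc unfolding cyclic_module_def by blast
  then obtain p n where pn: "p \<in> P" "n \<in> N" "x = p \<oplus>\<^bsub>M\<^esub> n"
    using ds unfolding internal_direct_sum_def set_add_def' by blast
  have c: "p \<in> carrier M" "n \<in> carrier M" using pn P.subset N.subset by auto
  have "\<exists>r\<in>carrier R. y = r \<odot>\<^bsub>M\<^esub> n" if y: "y \<in> N" for y
  proof -
    have yM: "y \<in> carrier M" using y N.subset by auto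
    then obtain r where r: "r \<in> carrier R" "y = r \<odot>\<^bsub>M\<^esub> x" using x(2) by blast
    have rc: "r \<odot>\<^bsub>M\<^esub> p \<in> carrier M" "r \<odot>\<^bsub>M\<^esub> n \<in> carrier M"
      using r(1) c by (auto intro: M.rsmult_closed)
    have y_eq: "y = r \<odot>\<^bsub>M\<^esub> p \<oplus>\<^bsub>M\<^esub> r \<odot>\<^bsub>M\<^esub> n"
      using r c pn(3) by (simp add: M.rsmult_module_distr)
    hence "r \<odot>\<^bsub>M\<^esub> p = y \<oplus>\<^bsub>M\<^esub> \<ominus>\<^bsub>M\<^esub> (r \<odot>\<^bsub>M\<^esub> n)"
      using rc by (simp add: M.M.a_assoc M.M.r_neg)
    moreover have "\<ominus>\<^bsub>M\<^esub> (r \<odot>\<^bsub>M\<^esub> n) \<in> N"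
      using N.m_inv_closed[OF N.smult_closed[OF r(1) pn(2)]] by (simp add: a_inv_def)
    ultimately have "r \<odot>\<^bsub>M\<^esub> p \<in> P \<inter> N"
      using N.m_closed[OF y] P.smult_closed[OF r(1) pn(1)] by simp
    hence "r \<odot>\<^bsub>M\<^esub> p = \<zero>\<^bsub>M\<^esub>" using ds by (auto simp: internal_direct_sum_def)
    thus ?thesis using y_eq rc r(1) by auto
  qed
  hence "N = {r \<odot>\<^bsub>M\<^esub> n |r. r \<in> carrier R}"
    using N.smult_closed pn(2) by blast
  thus ?thesis
    using pn(2) unfolding cyclic_module_def by (intro bexI[of _ n]) simp_all
qed

lemma cyclic_imp_finitely_generated:
  assumes M: "right_module R M" and "cyclic_module R M"
  shows "finitely_generated_module R M"
proof -
  interpret M: right_module R M by fact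
  obtain x where x: "x \<in> carrier M" "carrier M = {r \<odot>\<^bsub>M\<^esub> x |r. r \<in> carrier R}"
    using assms(2) unfolding cyclic_module_def by blast
  have "submodule (carrier M) R M"
    by (rule submoduleI_right[OF M]) (auto simp: M.rsmult_closed)
  moreover have "carrier M \<subseteq> H" if "{x} \<subseteq> H" "submodule H R M" for H
    using that x(2) submodule.smult_closed[OF that(2)] by auto
  ultimately have "(\<lambda>H. submodule H R M) hull {x} = carrier M"
    using x(1) by (intro hull_unique) auto
  thus ?thesis using x(1) unfolding finitely_generated_module_def by blast
qed

text \<open>A nonzero element \<open>x\<close> is separated from \<open>0\<close> by some \<open>f : M \<rightarrow> R\<close>. The image of \<open>f\<close> is a
  nonzero principal right ideal, hence projective, so \<open>M\<close> maps onto a nonzero projective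
  module.\<close>

lemma cyclic_torsionless_stable_imp_zero:
  assumes M: "right_module R M" and R: "right_semihereditary R"
    and cyc: "cyclic_module R M" and tl: "torsionless R M" and st: "stable_module R M"
  shows "carrier M = {\<zero>\<^bsub>M\<^esub>}"
proof (rule ccontr)
  interpret M: right_module R M by fact
  assume "carrier M \<noteq> {\<zero>\<^bsub>M\<^esub>}"
  then obtain x where x: "x \<in> carrier M" "x \<noteq> \<zero>\<^bsub>M\<^esub>" using M.M.zero_closed by blast
  obtain f where f: "f \<in> rmodule_hom R M (regular_module R)" and ne: "f x \<noteq> f \<zero>\<^bsub>M\<^esub>"
    using tl x M.M.zero_closed unfolding torsionless_iff_homs_separate by blast
  have RR: "right_module R (regular_module R)"
    by (rule right_module_regular_module[OF M.R.ring_axioms])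
  let ?B = "(regular_module R)\<lparr>carrier := f ` carrier M\<rparr>"
  have sub: "submodule (f ` carrier M) R (regular_module R)" by (rule submodule_image[OF M RR f])
  have "finitely_generated_module R ?B"
    by (rule cyclic_imp_finitely_generated[OF submodule_right_module[OF RR sub]
          cyclic_module_image[OF f cyc]])
  hence proj: "projective_module R ?B"
    using R sub unfolding right_semihereditary_def right_ideal_def by blast
  have "f \<in> rmodule_hom R M ?B" using f by (auto simp: rmodule_hom_def)
  from stable_epi_onto_projective_imp_zero[OF M st proj this]
  have "f ` carrier M = {\<zero>\<^bsub>R\<^esub>}" by simp
  thus False using ne x(1) M.M.zero_closed by (metis image_eqI singletonD)
qed


section \<open>Quotient modules\<close>

text \<open>The \<open>H\<close> added in the scalar multiplication is needed because the elementwise product of a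
  coset with a scalar need not be a full coset of \<open>H\<close>.\<close>

definition quotient_module :: "('a, 'm) module \<Rightarrow> 'm set \<Rightarrow> ('a, 'm set) module" where
  "quotient_module M H = \<lparr>carrier = a_rcosets\<^bsub>M\<^esub> H, mult = undefined, one = undefined,
     zero = H, add = (<+>\<^bsub>M\<^esub>), smult = (\<lambda>r C. H <+>\<^bsub>M\<^esub> (\<lambda>x. r \<odot>\<^bsub>M\<^esub> x) ` C)\<rparr>"

context
  fixes R :: "('a, 'r) ring_scheme" and M :: "('a, 'm) module" and H :: "'m set"
  assumes M: "right_module R M" and H: "submodule H R M"
begin

interpretation M: right_module R M by (rule M)
interpretation H: submodule H R M by (rule H)
interpretation A: abelian_subgroup H M
  by (rule abelian_subgroupI3[OF additive_subgroup.intro[OF H.subgroup_axioms]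
        M.M.abelian_group_axioms])

lemma quotient_module_carrier: "carrier (quotient_module M H) = (\<lambda>x. H +>\<^bsub>M\<^esub> x) ` carrier M"
  by (auto simp: quotient_module_def A_RCOSETS_def')

lemma coset_eq_iff:
  assumes "x \<in> carrier M" "y \<in> carrier M"
  shows "H +>\<^bsub>M\<^esub> x = H +>\<^bsub>M\<^esub> y \<longleftrightarrow> y \<oplus>\<^bsub>M\<^esub> \<ominus>\<^bsub>M\<^esub> x \<in> H"
  using A.a_rcos_module[OF assms] A.a_repr_independence'[of y x] A.a_repr_independenceD[of y x]
    assms by (auto simp: a_minus_def)

lemma quotient_module_smult_coset:
  assumes r: "r \<in> carrier R" and x: "x \<in> carrier M"
  shows "r \<odot>\<^bsub>quotient_module M H\<^esub> (H +>\<^bsub>M\<^esub> x) = H +>\<^bsub>M\<^esub> (r \<odot>\<^bsub>M\<^esub> x)"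
proof -
  have "H <+>\<^bsub>M\<^esub> (\<lambda>y. r \<odot>\<^bsub>M\<^esub> y) ` (H +>\<^bsub>M\<^esub> x) = H +>\<^bsub>M\<^esub> (r \<odot>\<^bsub>M\<^esub> x)"
  proof (intro equalityI subsetI)
    fix z assume "z \<in> H <+>\<^bsub>M\<^esub> (\<lambda>y. r \<odot>\<^bsub>M\<^esub> y) ` (H +>\<^bsub>M\<^esub> x)"
    then obtain h k where hk: "h \<in> H" "k \<in> H" "z = h \<oplus>\<^bsub>M\<^esub> r \<odot>\<^bsub>M\<^esub> (k \<oplus>\<^bsub>M\<^esub> x)"
      unfolding set_add_def' a_r_coset_def' by blast
    moreover have "h \<in> carrier M" "k \<in> carrier M" using hk H.subset by auto
    ultimately have "z = (h \<oplus>\<^bsub>M\<^esub> r \<odot>\<^bsub>M\<^esub> k) \<oplus>\<^bsub>M\<^esub> r \<odot>\<^bsub>M\<^esub> x"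
      using r x by (simp add: M.rsmult_module_distr M.rsmult_closed M.M.a_assoc)
    moreover have "h \<oplus>\<^bsub>M\<^esub> r \<odot>\<^bsub>M\<^esub> k \<in> H"
      using H.m_closed[OF hk(1) H.smult_closed[OF r hk(2)]] by simp
    ultimately show "z \<in> H +>\<^bsub>M\<^esub> (r \<odot>\<^bsub>M\<^esub> x)" unfolding a_r_coset_def' by blast
  next
    fix z assume "z \<in> H +>\<^bsub>M\<^esub> (r \<odot>\<^bsub>M\<^esub> x)"
    thus "z \<in> H <+>\<^bsub>M\<^esub> (\<lambda>y. r \<odot>\<^bsub>M\<^esub> y) ` (H +>\<^bsub>M\<^esub> x)"
      using A.a_rcos_self[OF x] unfolding set_add_def' a_r_coset_def'[of _ _ "r \<odot>\<^bsub>M\<^esub> x"] by blast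
  qed
  thus ?thesis by (simp add: quotient_module_def)
qed

lemma right_module_quotient_module: "right_module R (quotient_module M H)"
proof -
  let ?Q = "quotient_module M H"
  have zero: "\<zero>\<^bsub>?Q\<^esub> = H +>\<^bsub>M\<^esub> \<zero>\<^bsub>M\<^esub>"
    using A.a_rcos_const[OF A.zero_closed] by (simp add: quotient_module_def)
  have add: "(H +>\<^bsub>M\<^esub> x) \<oplus>\<^bsub>?Q\<^esub> (H +>\<^bsub>M\<^esub> y) = H +>\<^bsub>M\<^esub> (x \<oplus>\<^bsub>M\<^esub> y)"
    if "x \<in> carrier M" "y \<in> carrier M" for x y
    using A.a_rcos_sum[OF that] by (simp add: quotient_module_def)
  have ab: "abelian_group ?Q"
  proof (rule abelian_groupI; unfold quotient_module_carrier)
    fix C assume "C \<in> (\<lambda>x. H +>\<^bsub>M\<^esub> x) ` carrier M"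
    then obtain x where x: "x \<in> carrier M" "C = H +>\<^bsub>M\<^esub> x" by blast
    have "(H +>\<^bsub>M\<^esub> (\<ominus>\<^bsub>M\<^esub> x)) \<oplus>\<^bsub>?Q\<^esub> C = \<zero>\<^bsub>?Q\<^esub>"
      using x by (simp add: add zero M.M.l_neg)
    thus "\<exists>D\<in>(\<lambda>x. H +>\<^bsub>M\<^esub> x) ` carrier M. D \<oplus>\<^bsub>?Q\<^esub> C = \<zero>\<^bsub>?Q\<^esub>" using x(1) by blast
  qed (auto simp: add zero M.M.a_ac)
  show ?thesis
    by (intro right_module.intro right_module_axioms.intro M.R.ring_axioms ab;
        unfold quotient_module_carrier)
      (auto simp: quotient_module_smult_coset add M.rsmult_closed M.rsmult_ring_distr
        M.rsmult_module_distr M.rsmult_assoc M.rsmult_one)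
qed

lemma quotient_map_hom: "(\<lambda>x. H +>\<^bsub>M\<^esub> x) \<in> rmodule_hom R M (quotient_module M H)"
  by (rule rmodule_homI)
    (simp_all add: quotient_module_carrier quotient_module_smult_coset,
      simp add: quotient_module_def A.a_rcos_sum)

lemma quotient_module_hom_exists:
  assumes B: "right_module R B" and f: "f \<in> rmodule_hom R M B"
    and f0: "\<And>x. x \<in> H \<Longrightarrow> f x = \<zero>\<^bsub>B\<^esub>"
  shows "\<exists>g \<in> rmodule_hom R (quotient_module M H) B. \<forall>x\<in>carrier M. g (H +>\<^bsub>M\<^esub> x) = f x"
proof -
  interpret B: right_module R B by fact
  note f' = rmodule_homD[OF f]
  define g where "g = (\<lambda>C. f (SOME y. y \<in> C))"
  have g: "g (H +>\<^bsub>M\<^esub> x) = f x" if x: "x \<in> carrier M" for x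
  proof -
    have "(SOME y. y \<in> H +>\<^bsub>M\<^esub> x) \<in> H +>\<^bsub>M\<^esub> x"
      using A.a_rcos_self[OF x] by (rule someI)
    then obtain h where h: "h \<in> H" "(SOME y. y \<in> H +>\<^bsub>M\<^esub> x) = h \<oplus>\<^bsub>M\<^esub> x"
      by (auto simp: a_r_coset_def')
    have "f (h \<oplus>\<^bsub>M\<^esub> x) = f x"
      using h(1) x H.subset f0[OF h(1)] f' by (auto simp: subset_iff)
    thus ?thesis by (simp add: g_def h(2))
  qed
  have "g \<in> rmodule_hom R (quotient_module M H) B"
  proof (rule rmodule_homI; unfold quotient_module_carrier)
    fix C D assume "C \<in> (\<lambda>x. H +>\<^bsub>M\<^esub> x) ` carrier M" "D \<in> (\<lambda>x. H +>\<^bsub>M\<^esub> x) ` carrier M"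
    thus "g (C \<oplus>\<^bsub>quotient_module M H\<^esub> D) = g C \<oplus>\<^bsub>B\<^esub> g D"
      using g f'(2) by (auto simp: quotient_module_def A.a_rcos_sum)
  qed (auto simp: g f' quotient_module_smult_coset M.rsmult_closed)
  thus ?thesis using g by blast
qed

end

lemma cyclic_quotient_of_regular_module:
  assumes R: "ring R" and I: "right_ideal I R"
  shows "cyclic_module R (quotient_module (regular_module R) I)"
proof -
  interpret ring R by fact
  have "cyclic_module R (regular_module R)"
    unfolding cyclic_module_def by (intro bexI[of _ "\<one>\<^bsub>R\<^esub>"]) force+
  from cyclic_module_image[OF quotient_map_hom this] show ?thesis
    using right_module_regular_module[OF R] I quotient_module_carrier[of R "regular_module R" I]
    unfolding right_ideal_def by (metis partial_object.surjective partial_object.update_convs(1))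
qed

text \<open>If \<open>s\<close> splits the quotient map and \<open>u\<close> is the image under \<open>s\<close> of the coset of \<open>1\<close>, then
  left multiplication by \<open>u\<close> is a projection of \<open>R\<close> with kernel \<open>I\<close>, so \<open>e = 1 - u\<close>
  generates \<open>I\<close>.\<close>

lemma projective_quotient_imp_idempotent:
  fixes R (structure)
  assumes R: "ring R" and I: "right_ideal I R"
    and proj: "projective_module R (quotient_module (regular_module R) I)"
  shows "\<exists>e\<in>carrier R. e \<otimes>\<^bsub>R\<^esub> e = e \<and> I = {e \<otimes>\<^bsub>R\<^esub> r |r. r \<in> carrier R}"
proof -
  interpret ring R by fact
  let ?R = "regular_module R"
  let ?M = "quotient_module ?R I"
  have RR: "right_module R ?R" by (rule right_module_regular_module[OF R])
  have sub: "submodule I R ?R" using I by (simp add: right_ideal_def)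
  interpret I: submodule I R ?R by (rule sub)
  have IR: "a \<in> carrier R" if "a \<in> I" for a using that I.subset by auto
  define q where "q = (\<lambda>x. I +>\<^bsub>?R\<^esub> x)"
  have q: "q \<in> rmodule_hom R ?R ?M" unfolding q_def by (rule quotient_map_hom[OF RR sub])
  have q_eq: "q a = q b \<longleftrightarrow> b \<oplus>\<^bsub>?R\<^esub> \<ominus>\<^bsub>?R\<^esub> a \<in> I" if "a \<in> carrier R" "b \<in> carrier R" for a b
    unfolding q_def using coset_eq_iff[OF RR sub] that by simp
  note neg = regular_module_neg[OF R]
  obtain s where s: "s \<in> rmodule_hom R ?M ?R" and qs: "\<And>b. b \<in> carrier ?M \<Longrightarrow> q (s b) = b"
    using epi_onto_projective_splits[OF RR proj q] quotient_module_carrier[OF RR sub]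
    unfolding q_def by blast
  define u where "u = s (q \<one>)"
  have q1: "q \<one> \<in> carrier ?M" using rmodule_homD(1)[OF q, of \<one>] by simp
  have u: "u \<in> carrier R" using rmodule_homD(1)[OF s q1] by (simp add: u_def)
  have sq: "s (q a) = u \<otimes> a" if "a \<in> carrier R" for a
    using rmodule_homD(3)[OF q that, of \<one>] rmodule_homD(3)[OF s that q1] that
    by (simp add: u_def)
  have eI: "\<one> \<oplus> \<ominus> u \<in> I"
    using q_eq[OF u one_closed] qs[OF q1] u by (simp add: u_def[symmetric] neg)
  have uI: "u \<otimes> a = \<zero>" if a: "a \<in> I" for a
  proof -
    have "q a = q \<zero>" using q_eq[of \<zero> a] a IR[OF a] by (simp add: neg)
    thus ?thesis using sq[OF IR[OF a]] sq[of \<zero>] u by simp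
  qed
  have eI_id: "(\<one> \<oplus> \<ominus> u) \<otimes> a = a" if a: "a \<in> I" for a
    using uI[OF a] IR[OF a] u by (simp add: l_distr l_minus)
  have "I = {(\<one> \<oplus> \<ominus> u) \<otimes> r |r. r \<in> carrier R}"
  proof (intro equalityI subsetI)
    fix a assume "a \<in> I"
    thus "a \<in> {(\<one> \<oplus> \<ominus> u) \<otimes> r |r. r \<in> carrier R}" using eI_id[of a] IR[of a] by force
  next
    fix a assume "a \<in> {(\<one> \<oplus> \<ominus> u) \<otimes> r |r. r \<in> carrier R}"
    thus "a \<in> I" using I.smult_closed[OF _ eI] by auto
  qed
  thus ?thesis using eI_id[OF eI] u by (intro bexI[of _ "\<one> \<oplus> \<ominus> u"]) auto
qed


section \<open>Quotients by annihilators\<close>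

lemma right_ideal_right_annihilator:
  assumes R: "ring R" and X: "X \<subseteq> carrier R"
  shows "right_ideal (right_annihilator R X) R"
proof -
  interpret ring R by fact
  show ?thesis
    unfolding right_ideal_def
    by (rule submoduleI_right[OF right_module_regular_module[OF R]])
      (use X in \<open>auto simp: right_annihilator_def r_distr m_assoc[symmetric] subset_iff\<close>)
qed

text \<open>Left multiplication by \<open>x \<in> X\<close> kills the annihilator, so it induces a homomorphism on the
  quotient. Elements \<open>a\<close> and \<open>b\<close> of \<open>R\<close> with \<open>x a = x b\<close> for all \<open>x \<in> X\<close> differ by an
  element of the annihilator, so these homomorphisms separate the cosets.\<close>

lemma torsionless_quotient_right_annihilator:
  fixes R (structure)
  assumes R: "ring R" and X: "X \<subseteq> carrier R"
  shows "torsionless R (quotient_module (regular_module R) (right_annihilator R X))"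
    (is "torsionless R (quotient_module ?R ?I)")
proof -
  interpret ring R by fact
  have RR: "right_module R ?R" by (rule right_module_regular_module[OF R])
  have sub: "submodule ?I R ?R"
    using right_ideal_right_annihilator[OF R X] by (simp add: right_ideal_def)
  note neg = regular_module_neg[OF R]
  show ?thesis
    unfolding torsionless_iff_homs_separate
  proof (intro ballI impI)
    fix C D assume "C \<in> carrier (quotient_module ?R ?I)" "D \<in> carrier (quotient_module ?R ?I)"
      and ne: "C \<noteq> D"
    then obtain a b where ab: "a \<in> carrier R" "b \<in> carrier R" "C = ?I +>\<^bsub>?R\<^esub> a" "D = ?I +>\<^bsub>?R\<^esub> b"
      unfolding quotient_module_carrier[OF RR sub] by auto
    have "b \<oplus> \<ominus> a \<notin> ?I"
      using coset_eq_iff[OF RR sub, of a b] ab ne by (simp add: neg)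
    then obtain x where x: "x \<in> X" "x \<otimes> (b \<oplus> \<ominus> a) \<noteq> \<zero>"
      using ab by (auto simp: right_annihilator_def)
    have xR: "x \<in> carrier R" using x(1) X by auto
    have "(\<lambda>r. x \<otimes> r) \<in> rmodule_hom R ?R ?R"
      using xR by (intro rmodule_homI) (auto simp: r_distr m_assoc)
    then obtain g where g: "g \<in> rmodule_hom R (quotient_module ?R ?I) ?R"
      "\<forall>r\<in>carrier ?R. g (?I +>\<^bsub>?R\<^esub> r) = x \<otimes> r"
      using quotient_module_hom_exists[OF RR sub RR, of "\<lambda>r. x \<otimes> r"] x(1)
      by (auto simp: right_annihilator_def)
    have "x \<otimes> a \<noteq> x \<otimes> b"
      using x(2) xR ab by (auto simp: r_distr r_minus r_neg)
    thus "\<exists>f\<in>rmodule_hom R (quotient_module ?R ?I) ?R. f C \<noteq> f D"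
      using g ab by (intro bexI[of _ g]) auto
  qed
qed

theorem theorem4p3:
  fixes R :: "('a, 'r) ring_scheme"
  assumes "ring R"
    and "right_semihereditary R"
    and "\<not> right_Baer R"
  shows "\<exists>M :: ('a, 'a set) module.
    right_module R M \<and> cyclic_module R M \<and> torsionless R M \<and>
    \<not> (\<exists>P N. internal_direct_sum R M P N \<and>
          projective_module R (M\<lparr>carrier := P\<rparr>) \<and> stable_module R (M\<lparr>carrier := N\<rparr>))"
proof -
  obtain X where X: "X \<subseteq> carrier R"
    and not_idem: "\<not> (\<exists>e\<in>carrier R. e \<otimes>\<^bsub>R\<^esub> e = e \<and>
      right_annihilator R X = {e \<otimes>\<^bsub>R\<^esub> r |r. r \<in> carrier R})"
    using assms(3) unfolding right_Baer_def by blast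
  define M where "M = quotient_module (regular_module R) (right_annihilator R X)"
  have I: "right_ideal (right_annihilator R X) R"
    by (rule right_ideal_right_annihilator[OF assms(1) X])
  have M: "right_module R M"
    unfolding M_def
    by (rule right_module_quotient_module[OF right_module_regular_module[OF assms(1)]
          I[unfolded right_ideal_def]])
  have cyc: "cyclic_module R M"
    unfolding M_def by (rule cyclic_quotient_of_regular_module[OF assms(1) I])
  have tl: "torsionless R M"
    unfolding M_def by (rule torsionless_quotient_right_annihilator[OF assms(1) X])
  have "\<not> stable_module R (M\<lparr>carrier := N\<rparr>)"
    if ds: "internal_direct_sum R M P N" and proj: "projective_module R (M\<lparr>carrier := P\<rparr>)" for P N
  proof
    assume st: "stable_module R (M\<lparr>carrier := N\<rparr>)"
    have P: "submodule P R M" and N: "submodule N R M" and sum: "P <+>\<^bsub>M\<^esub> N = carrier M"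
      using ds by (auto simp: internal_direct_sum_def)
    have "N = {\<zero>\<^bsub>M\<^esub>}"
      using cyclic_torsionless_stable_imp_zero[OF submodule_right_module[OF M N] assms(2)
          cyclic_module_direct_summand[OF M cyc ds] torsionless_submodule[OF tl N] st] by simp
    moreover have "x \<oplus>\<^bsub>M\<^esub> \<zero>\<^bsub>M\<^esub> = x" if "x \<in> P" for x
    proof -
      interpret M: right_module R M by fact
      show ?thesis using subgroup.subset[OF submodule.axioms(1)[OF P]] that by auto
    qed
    ultimately have "P = carrier M"
      using sum by (simp add: set_add_def')
    hence "projective_module R M" using proj by simp
    thus False
      using projective_quotient_imp_idempotent[OF assms(1) I] not_idem unfolding M_def by blast
  qed
  thus ?thesis using M cyc tl by blast
qed

end
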